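(* Let $K\subset\mathbb{R}^n$ be a closed and convex set and let $U\subset\mathbb{R}^n$ be an affine manifold. Assume that $K\cap U\neq\emptyset$ and that there exists $\omega\in(0,1)$ such that $\operatorname{dist}(x,K)\ge\omega\operatorname{dist}(x,K\cap U)$ for all $x\in U$. Let $(z^k)_{k\in\mathbb{N}}$ and $(x^k)_{k\in\mathbb{N}}$ be the sequences generated by MAP and CRM, respectively, i.e. $z^{k+1}=T(z^k)$ and $x^{k+1}=C(x^k)$, starting from arbitrary points $z^0\in\mathbb{R}^n$ and $x^0\in U$. Then both sequences $(z^k)_{k\in\mathbb{N}}$ and $(x^k)_{k\in\mathbb{N}}$ converge R-linearly to points in $K\cap U$, and the asymptotic constants are bounded above by $\sqrt{1-\omega^2}$ for MAP, and by $\sqrt{\dfrac{1-\omega^2}{1+\omega^2}}$ for CRM.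
   Context: An affine manifold is an affine subspace of $\mathbb{R}^n$; $\operatorname{dist}$ is the Euclidean distance. $P_K,P_U$ are the orthogonal projections onto $K,U$; $R_K=2P_K-\mathrm{Id}$ and $R_U=2P_U-\mathrm{Id}$ are the reflections. The operator of the Method of Alternating Projections (MAP) is $T=P_U\circ P_K$. The operator of the Circumcentered-Reflection Method (CRM) is $C(x)=\operatorname{circ}(x,R_K(x),R_U(R_K(x)))$, where the circumcenter $\operatorname{circ}(a,b,c)$ is the point of the affine hull $\operatorname{aff}\{a,b,c\}$ equidistant from $a,b,c$. When $K\cap U\neq\emptyset$, it is known that for every $x\in U$ the point $C(x)$ is well defined and belongs to $U$, so the CRM sequence is well defined. Convergence rates are defined as follows. Let $(y^k)_{k\in\mathbb{N}}\subset\mathbb{R}^n$ converge to $y^*$, and assume that $y^k\ne y^*$ for all $k$. Put $r=\limsup_{k\to\infty}\|y^k-y^*\|^{1/k}$. The convergence is R-superlinear if $r=0$, R-linear if $r\in(0,1)$, and R-sublinear if $r\ge1$; the value $r$ is called the (R-)asymptotic constant of the sequence.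
   Formalization: "Converge R-linearly" is read as "at least R-linearly": reaching the limit after finitely many steps, or R-superlinear convergence (r=0), is also allowed, since K=U gives eventually constant sequences and CRM for a disc and a line through its interior can have r=0. *)

theory Defs
  imports "HOL-Analysis.Analysis"
begin

definition reflect :: "'a::euclidean_space set \<Rightarrow> 'a \<Rightarrow> 'a" where
  "reflect S x = 2 *\<^sub>R closest_point S x - x"

definition is_circumcenter :: "'a::euclidean_space \<Rightarrow> 'a \<Rightarrow> 'a \<Rightarrow> 'a \<Rightarrow> bool" where
  "is_circumcenter a b c p \<longleftrightarrow>
     p \<in> affine hull {a, b, c} \<and> dist p a = dist p b \<and> dist p b = dist p c"

text \<open>There is at most one circumcenter; there is none exactly when the three points are collinear
  and pairwise distinct, in which case the value below is unspecified. If two or all three points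
  coincide, it is the midpoint of the two distinct values or the common value, respectively.\<close>

definition circ :: "'a::euclidean_space \<Rightarrow> 'a \<Rightarrow> 'a \<Rightarrow> 'a" where
  "circ a b c = (THE p. is_circumcenter a b c p)"

definition MAP_op :: "'a::euclidean_space set \<Rightarrow> 'a set \<Rightarrow> 'a \<Rightarrow> 'a" where
  "MAP_op K U x = closest_point U (closest_point K x)"

definition CRM_op :: "'a::euclidean_space set \<Rightarrow> 'a set \<Rightarrow> 'a \<Rightarrow> 'a" where
  "CRM_op K U x = circ x (reflect K x) (reflect U (reflect K x))"

text \<open>The upper limit is taken in the extended reals, so it always exists. The (junk) value of the
  exponent at \<open>k = 0\<close> does not affect it. The constant is \<open>0\<close> for a sequence that is eventually
  equal to its limit.\<close>

definition R_constant :: "(nat \<Rightarrow> 'a::euclidean_space) \<Rightarrow> 'a \<Rightarrow> ereal" where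
  "R_constant y l = limsup (\<lambda>k. ereal (norm (y k - l) powr (1 / real k)))"

definition R_superlinear :: "(nat \<Rightarrow> 'a::euclidean_space) \<Rightarrow> 'a \<Rightarrow> bool" where
  "R_superlinear y l \<longleftrightarrow> y \<longlonglongrightarrow> l \<and> (\<forall>k. y k \<noteq> l) \<and> R_constant y l = 0"

definition R_linear :: "(nat \<Rightarrow> 'a::euclidean_space) \<Rightarrow> 'a \<Rightarrow> bool" where
  "R_linear y l \<longleftrightarrow> y \<longlonglongrightarrow> l \<and> (\<forall>k. y k \<noteq> l) \<and> 0 < R_constant y l \<and> R_constant y l < 1"

text \<open>A rate guarantee of the form ``converges R-linearly'' means that convergence is at least that
  fast. Neither faster alternative can be excluded for the two methods: if \<open>K = U\<close>, both reach
  their limit after at most one step, and if \<open>K\<close> is a disc and \<open>U\<close> a line through its interior,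
  the circumcentered-reflection method can converge superlinearly without ever reaching its limit.\<close>

definition converges_R_linearly :: "(nat \<Rightarrow> 'a::euclidean_space) \<Rightarrow> 'a \<Rightarrow> bool" where
  "converges_R_linearly y l \<longleftrightarrow>
     (\<exists>N. \<forall>k\<ge>N. y k = l) \<or> R_superlinear y l \<or> R_linear y l"

end

theory Submission
  imports Defs
begin

text \<open>
  Both methods are Fejer monotone with respect to \<open>S = K \<inter> U\<close> (no iterate is farther from any
  point of \<open>S\<close> than its predecessor), and each step on \<open>U\<close> shrinks the distance to \<open>S\<close> by a fixed
  factor. Fejer monotonicity turns the decay of the distance to the set into convergence to a single
  point at the same rate: all later iterates stay in the ball around the projection of \<open>y k\<close> onto
  \<open>S\<close> whose radius is the distance of \<open>y k\<close> to \<open>S\<close>, so they stay within twice that distance of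
  \<open>y k\<close> (\<open>Fejer_geometric_imp_R_linear\<close>). What remains are the two contraction factors.

  Let \<open>d\<close> denote the distance to \<open>S\<close>, let \<open>x \<in> U\<close>, and let \<open>p\<close> be its projection onto \<open>K\<close>.
  For MAP, the obtuse angle at \<open>p\<close> and the nonexpansiveness of the projection onto \<open>U\<close> give \<open>d(T x)\<^sup>2 \<le> d(x)\<^sup>2 - |x - p|\<^sup>2\<close>, and the error bound
  \<open>|x - p| \<ge> \<omega> d(x)\<close> yields the factor \<open>1 - \<omega>\<^sup>2\<close> for the squared distances
  (\<open>MAP_op_contracts\<close>).

  For CRM, the point \<open>c = C x\<close> is the projection of \<open>x\<close> onto \<open>U \<inter> H\<close>, where \<open>H\<close> is the
  half-space that contains \<open>K\<close> and is bounded by the hyperplane through \<open>p\<close> orthogonal to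
  \<open>x - p\<close> (\<open>CRM_op_characterization\<close>). Since \<open>S \<subseteq> U \<inter> H\<close>, the obtuse angle at \<open>c\<close> gives
  \<open>d(c)\<^sup>2 \<le> d(x)\<^sup>2 - |x - c|\<^sup>2\<close>. Moreover \<open>c\<close> lies on that hyperplane and in \<open>U\<close>, so the error
  bound at \<open>c\<close> gives \<open>\<omega>\<^sup>2 d(c)\<^sup>2 \<le> |c - p|\<^sup>2 = |x - c|\<^sup>2 - |x - p|\<^sup>2\<close>. In the sum of the two
  inequalities \<open>|x - c|\<close> cancels, and the error bound at \<open>x\<close> leaves
  \<open>(1 + \<omega>\<^sup>2) d(c)\<^sup>2 \<le> (1 - \<omega>\<^sup>2) d(x)\<^sup>2\<close> (\<open>CRM_op_contracts\<close>).
\<close>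

section \<open>Projections\<close>

text \<open>The angle at the projection is obtuse, so the law of cosines gives the
  Pythagorean relation as an inequality.\<close>

lemma closest_point_pythagoras:
  fixes K :: "'a::euclidean_space set"
  assumes "closed K" "convex K" "s \<in> K"
  shows "(dist x (closest_point K x))\<^sup>2 + (dist (closest_point K x) s)\<^sup>2 \<le> (dist x s)\<^sup>2"
proof -
  let ?p = "closest_point K x"
  have "inner (x - ?p) (s - ?p) \<le> 0"
    using closest_point_dot assms by blast
  then show ?thesis
    by (simp add: dist_norm power2_norm_eq_inner inner_diff_left inner_diff_right inner_commute)
qed

text \<open>Both \<open>q + (a - b)\<close> and \<open>q - (a - b)\<close> belong to \<open>U\<close> when \<open>q\<close> is the projection, so the
  obtuse-angle inequality holds in both directions.\<close>

lemma closest_point_affine_orthogonal: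
  fixes U :: "'a::euclidean_space set"
  assumes "affine U" "a \<in> U" "b \<in> U"
  shows "inner (x - closest_point U x) (a - b) = 0"
proof -
  let ?q = "closest_point U x"
  have U: "closed U" "convex U" "U \<noteq> {}"
    using assms by (auto simp: affine_closed affine_imp_convex)
  then have q: "?q \<in> U"
    by (simp add: closest_point_in_set)
  have "?q + 1 *\<^sub>R (a - b) \<in> U" "?q + 1 *\<^sub>R (b - a) \<in> U"
    using mem_affine_3_minus[OF assms(1) q assms(2,3)]
      mem_affine_3_minus[OF assms(1) q assms(3,2)] by blast+
  then have "inner (x - ?q) (a - b) \<le> 0" "inner (x - ?q) (b - a) \<le> 0"
    using closest_point_dot[OF U(2,1), of "?q + 1 *\<^sub>R (a - b)" x]
      closest_point_dot[OF U(2,1), of "?q + 1 *\<^sub>R (b - a)" x] by simp_all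
  then show ?thesis
    by (simp add: inner_diff_right)
qed

lemma closest_point_eq_of_orthogonal:
  fixes U :: "'a::euclidean_space set"
  assumes "affine U" "q \<in> U" and orth: "\<And>u. u \<in> U \<Longrightarrow> inner (x - q) (u - q) = 0"
  shows "closest_point U x = q"
proof -
  have U: "closed U" "convex U" "U \<noteq> {}"
    using assms by (auto simp: affine_closed affine_imp_convex)
  let ?r = "closest_point U x"
  have r: "?r \<in> U"
    using U by (simp add: closest_point_in_set)
  have "inner (x - ?r) (?r - q) = 0"
    using closest_point_affine_orthogonal[OF assms(1) r assms(2)] .
  with orth[OF r] have "inner (?r - q) (?r - q) = 0"
    by (simp add: inner_diff_left)
  then show ?thesis by simp
qed

lemma infdist_eq_dist_closest_point:
  fixes S :: "'a::euclidean_space set"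
  assumes "closed S" "S \<noteq> {}"
  shows "infdist x S = dist x (closest_point S x)"
  using assms setdist_closest_point[of S x] by (simp add: infdist_eq_setdist)

section \<open>Circumcenters\<close>

text \<open>The difference of two circumcenters lies in the span of \<open>b - a\<close> and \<open>c - a\<close> and, by
  equidistance, is orthogonal to both vectors.\<close>

lemma is_circumcenter_unique:
  assumes "is_circumcenter a b c p" "is_circumcenter a b c q"
  shows "p = q"
proof -
  have ph: "p \<in> affine hull {a, b, c}" and qh: "q \<in> affine hull {a, b, c}"
    and d: "dist p a = dist p b" "dist p b = dist p c" "dist q a = dist q b" "dist q b = dist q c"
    using assms by (auto simp: is_circumcenter_def)
  obtain u v w where p: "p = u *\<^sub>R a + v *\<^sub>R b + w *\<^sub>R c" "u + v + w = 1"
    using ph by (auto simp: affine_hull_3)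
  obtain u' v' w' where q: "q = u' *\<^sub>R a + v' *\<^sub>R b + w' *\<^sub>R c" "u' + v' + w' = 1"
    using qh by (auto simp: affine_hull_3)
  have uu: "u = 1 - v - w" "u' = 1 - v' - w'"
    using p q by auto
  have eq: "p - q = (v - v') *\<^sub>R (b - a) + (w - w') *\<^sub>R (c - a)"
    unfolding p(1) q(1) uu by (simp add: algebra_simps)
  have sq: "inner (r - s) (r - s) = inner (r - t) (r - t)" if "dist r s = dist r t" for r s t :: 'a
    using that by (simp add: dist_norm norm_eq)
  note d' = d[THEN sq]
  have "inner (p - q) (b - a) = 0" "inner (p - q) (c - a) = 0"
    using d' by (simp_all add: inner_diff_left inner_diff_right inner_commute)
  moreover have "inner (p - q) (p - q) =
      (v - v') * inner (p - q) (b - a) + (w - w') * inner (p - q) (c - a)"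
    by (subst (2) eq) (simp add: inner_add_right)
  ultimately show ?thesis by simp
qed

lemma circ_eqI: "is_circumcenter a b c p \<Longrightarrow> circ a b c = p"
  unfolding circ_def using is_circumcenter_unique by blast

section \<open>Fejer monotone sequences\<close>

text \<open>If the sequence meets its limit, it stays there, since the limit belongs to \<open>S\<close> and the
  distance to it cannot grow. Otherwise the root of the error bound \<open>2 * c * b ^ k\<close> tends to \<open>b\<close>.\<close>

lemma Fejer_geometric_imp_R_linear:
  fixes y :: "nat \<Rightarrow> 'a::euclidean_space"
  assumes S: "closed S" "S \<noteq> {}"
    and fejer: "\<And>k s. s \<in> S \<Longrightarrow> dist (y (Suc k)) s \<le> dist (y k) s"
    and geo: "\<And>k. infdist (y k) S \<le> c * b ^ k"
    and b: "0 < b" "b < 1"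
  shows "\<exists>l\<in>S. y \<longlonglongrightarrow> l \<and> converges_R_linearly y l \<and> R_constant y l \<le> ereal b"
proof -
  have mono: "dist (y m) s \<le> dist (y k) s" if "k \<le> m" "s \<in> S" for k m s
    using that(1)
  proof (induction m rule: dec_induct)
    case (step n)
    then show ?case using fejer[OF that(2), of n] by linarith
  qed simp
  have near: "dist (y m) (y k) \<le> 2 * (c * b ^ k)" if "k \<le> m" for k m
  proof -
    let ?s = "closest_point S (y k)"
    have s: "?s \<in> S" using S by (simp add: closest_point_in_set)
    have "dist (y k) ?s \<le> c * b ^ k"
      using geo[of k] infdist_eq_dist_closest_point[OF S] by simp
    then show ?thesis
      using mono[OF that s] dist_triangle2[of "y m" "y k" ?s] by linarith
  qed
  have lim0: "(\<lambda>k. a * b ^ k) \<longlonglongrightarrow> 0" for a :: real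
    using tendsto_mult_right_zero[OF LIMSEQ_realpow_zero[of b], of a] b by simp
  have "Cauchy y"
  proof (rule metric_CauchyI)
    fix e :: real assume e: "0 < e"
    then have "\<forall>\<^sub>F k in sequentially. (4 * c) * b ^ k < e"
      by (rule order_tendstoD(2)[OF lim0])
    then obtain N where N: "(4 * c) * b ^ N < e"
      by (auto simp: eventually_sequentially)
    have "dist (y m) (y n) < e" if "N \<le> m" "N \<le> n" for m n
      using near[OF that(1)] near[OF that(2)] dist_triangle2[of "y m" "y n" "y N"] N by linarith
    then show "\<exists>M. \<forall>m\<ge>M. \<forall>n\<ge>M. dist (y m) (y n) < e" by blast
  qed
  then obtain l where l: "y \<longlonglongrightarrow> l"
    by (auto simp: Cauchy_convergent_iff convergent_def)
  have "(\<lambda>k. infdist (y k) S) \<longlonglongrightarrow> infdist l S"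
    by (intro tendsto_intros l)
  then have "infdist l S \<le> 0"
    using LIMSEQ_le[OF _ lim0] geo by blast
  then have lS: "l \<in> S"
    using S in_closed_iff_infdist_zero infdist_nonneg[of l S] by (metis order_antisym)
  have bound: "norm (y k - l) \<le> 2 * c * b ^ k" for k
  proof -
    have "(\<lambda>m. dist (y m) (y k)) \<longlonglongrightarrow> dist l (y k)"
      by (intro tendsto_intros l)
    then have "dist l (y k) \<le> 2 * (c * b ^ k)"
      using LIMSEQ_le_const2 near by blast
    then show ?thesis by (simp add: dist_norm norm_minus_commute)
  qed
  \<comment> \<open>The maximum makes the constant positive, so that its roots tend to \<open>1\<close>.\<close>
  define C where "C = max 1 (2 * c)"
  have C0: "C \<noteq> 0" by (auto simp: C_def)
  have root: "norm (y k - l) powr (1 / real k) \<le> C powr (1 / real k) * b" if "1 \<le> k" for k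
  proof -
    have "2 * c * b ^ k \<le> C * b ^ k"
      using b by (intro mult_right_mono) (auto simp: C_def)
    then have "norm (y k - l) powr (1 / real k) \<le> (C * b ^ k) powr (1 / real k)"
      using bound[of k] by (intro powr_mono2) auto
    also have "\<dots> = C powr (1 / real k) * (b powr real k) powr (1 / real k)"
      using b by (simp add: powr_mult C_def powr_realpow)
    also have "\<dots> = C powr (1 / real k) * b"
      using b that by (simp add: powr_powr)
    finally show ?thesis .
  qed
  have "(\<lambda>k. 1 / real k) \<longlonglongrightarrow> 0"
    using lim_1_over_n by simp
  then have "(\<lambda>k. C powr (1 / real k) * b) \<longlonglongrightarrow> C powr 0 * b"
    by (intro tendsto_intros) (auto simp: C_def)
  then have "(\<lambda>k. ereal (C powr (1 / real k) * b)) \<longlonglongrightarrow> ereal b"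
    by (simp add: C0)
  then have "limsup (\<lambda>k. ereal (C powr (1 / real k) * b)) = ereal b"
    by (intro lim_imp_Limsup) auto
  moreover have "R_constant y l \<le> limsup (\<lambda>k. ereal (C powr (1 / real k) * b))"
    unfolding R_constant_def
    by (intro Limsup_mono eventually_sequentiallyI[of 1]) (use root in simp)
  ultimately have R: "R_constant y l \<le> ereal b" by simp
  have "0 \<le> limsup (\<lambda>k. ereal (norm (y k - l) powr (1 / real k)))"
    by (rule le_Limsup) auto
  then have R0: "0 \<le> R_constant y l"
    unfolding R_constant_def .
  have "converges_R_linearly y l"
  proof (cases "\<exists>N. y N = l")
    case True
    then obtain N where "y N = l" ..
    then have "y k = l" if "N \<le> k" for k
      using mono[OF that lS] by simp
    then show ?thesis unfolding converges_R_linearly_def by blast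
  next
    case False
    have "R_constant y l < 1"
      using R b(2) by (metis ereal_less(3) order_le_less_trans)
    then show ?thesis
      using R0 False l
      unfolding converges_R_linearly_def R_superlinear_def R_linear_def by force
  qed
  with l lS R show ?thesis by blast
qed

section \<open>The method of alternating projections\<close>

lemma MAP_op_Fejer:
  assumes "closed K" "convex K" "affine U" "s \<in> K \<inter> U"
  shows "dist (MAP_op K U x) s \<le> dist x s"
proof -
  have U: "closed U" "convex U" using assms by (auto simp: affine_closed affine_imp_convex)
  have "dist (MAP_op K U x) s \<le> dist (closest_point K x) s"
    using closest_point_lipschitz[OF U(2,1), of "closest_point K x" s] assms
    by (auto simp: MAP_op_def closest_point_self)
  also have "\<dots> \<le> dist x s"
    using closest_point_lipschitz[OF assms(2,1), of x s] assms by (auto simp: closest_point_self)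
  finally show ?thesis .
qed

lemma MAP_op_contracts:
  assumes K: "closed K" "convex K" and U: "affine U" and ne: "K \<inter> U \<noteq> {}"
    and w: "0 \<le> w" "w \<le> 1" and eb: "w * infdist x (K \<inter> U) \<le> infdist x K"
  shows "infdist (MAP_op K U x) (K \<inter> U) \<le> sqrt (1 - w\<^sup>2) * infdist x (K \<inter> U)"
proof -
  let ?S = "K \<inter> U" and ?p = "closest_point K x"
  have cU: "closed U" "convex U" using U by (auto simp: affine_closed affine_imp_convex)
  have S: "closed ?S" using K cU by blast
  define s where "s = closest_point ?S x"
  have s: "s \<in> ?S" using S ne unfolding s_def by (rule closest_point_in_set)
  have xs: "infdist x ?S = dist x s" unfolding s_def by (rule infdist_eq_dist_closest_point[OF S ne])
  have xp: "infdist x K = dist x ?p"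
    using K ne by (intro infdist_eq_dist_closest_point) auto
  have "(infdist (MAP_op K U x) ?S)\<^sup>2 \<le> (dist (MAP_op K U x) s)\<^sup>2"
    using s by (intro power_mono infdist_le infdist_nonneg)
  also have "\<dots> \<le> (dist ?p s)\<^sup>2"
    using closest_point_lipschitz[OF cU(2,1), of ?p s] s
    by (intro power_mono) (auto simp: MAP_op_def closest_point_self)
  also have "\<dots> \<le> (dist x s)\<^sup>2 - (dist x ?p)\<^sup>2"
    using closest_point_pythagoras[OF K, of s x] s by simp
  also have "\<dots> \<le> (dist x s)\<^sup>2 - (w * dist x s)\<^sup>2"
    using eb w by (simp add: xs xp power_mono)
  also have "\<dots> = (1 - w\<^sup>2) * (infdist x ?S)\<^sup>2"
    by (simp add: xs algebra_simps power_mult_distrib)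
  finally have "infdist (MAP_op K U x) ?S \<le> sqrt ((1 - w\<^sup>2) * (infdist x ?S)\<^sup>2)"
    by (rule real_le_rsqrt)
  then show ?thesis
    by (simp only: real_sqrt_mult real_sqrt_abs abs_of_nonneg[OF infdist_nonneg])
qed

section \<open>The circumcentered-reflection method\<close>

text \<open>
  The three conclusions are the optimality conditions for \<open>c\<close> to be the projection of \<open>x\<close> onto the
  intersection of \<open>U\<close> with the half-space \<open>{h. inner (x - p) (h - p) \<le> 0}\<close>: feasibility with the
  half-space constraint active, and \<open>x - c\<close> a nonnegative multiple of \<open>x - p\<close> up to a vector
  orthogonal to \<open>U\<close>.

  Let \<open>q\<close> be the projection of \<open>p\<close> onto \<open>U\<close>. The points \<open>x\<close>, \<open>y\<close> and \<open>w\<close> are the point \<open>x\<close>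
  and its successive reflections. Since \<open>y\<close> and \<open>w\<close> are mirror images in \<open>U\<close>, all points
  \<open>x + t (q - x)\<close> of \<open>U\<close> are equidistant from them; equidistance from \<open>x\<close> and \<open>y\<close> means that
  the point lies on the hyperplane through the midpoint \<open>p\<close> orthogonal to \<open>x - p\<close>, which
  determines \<open>t\<close>. If \<open>q = x\<close>, this line degenerates; then \<open>p - x\<close> is orthogonal to \<open>U\<close>, and a
  common point of \<open>K\<close> and \<open>U\<close> forces \<open>p = x\<close>.
\<close>

lemma CRM_op_characterization:
  fixes K U :: "'a::euclidean_space set"
  assumes K: "closed K" "convex K" and U: "affine U" and ne: "K \<inter> U \<noteq> {}" and x: "x \<in> U"
  defines "p \<equiv> closest_point K x"
  defines "c \<equiv> CRM_op K U x"
  shows "c \<in> U \<and> inner (x - p) (c - p) = 0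
    \<and> (\<exists>t\<ge>0. \<forall>u\<in>U. inner (x - c) (u - c) = t * inner (x - p) (u - c))"
proof -
  define q where "q = closest_point U p"
  have "U \<noteq> {}" using x by blast
  then have q: "q \<in> U"
    using affine_closed[OF U] unfolding q_def by (intro closest_point_in_set)
  have orth: "inner (p - q) (u - v) = 0" if "u \<in> U" "v \<in> U" for u v
    using closest_point_affine_orthogonal[OF U that] unfolding q_def .
  define y where "y = reflect K x"
  define m where "m = 2 *\<^sub>R q - x"
  define w where "w = reflect U y"
  have y: "y = 2 *\<^sub>R p - x"
    unfolding y_def reflect_def p_def ..
  have m: "m \<in> U"
    using mem_affine[OF U q x, of 2 "-1"] by (simp add: m_def)
  have ym: "y - m = 2 *\<^sub>R (p - q)"
    by (simp add: y m_def algebra_simps)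
  \<comment> \<open>The projection onto \<open>U\<close> is affine and fixes \<open>x\<close>, so it sends \<open>2 p - x\<close> to \<open>2 q - x\<close>.\<close>
  have "closest_point U y = m"
    by (intro closest_point_eq_of_orthogonal[OF U m]) (simp add: ym orth m)
  then have w: "w = 2 *\<^sub>R m - y"
    by (simp add: w_def reflect_def)
  have c: "c = circ x y w"
    by (simp add: c_def CRM_op_def y_def w_def)
  show ?thesis
  proof (cases "q = x")
    case True
    obtain s where s: "s \<in> K" "s \<in> U" using ne by blast
    have "inner (x - p) (s - p) \<le> 0"
      using closest_point_dot[OF K(2,1) s(1)] unfolding p_def .
    moreover have "inner (p - x) (s - x) = 0"
      using orth[OF s(2) x] True by simp
    ultimately have "inner (x - p) (x - p) \<le> 0"
      by (simp add: inner_diff_left inner_diff_right)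
    then have px: "p = x"
      by (metis eq_iff_diff_eq_0 inner_eq_zero_iff inner_ge_zero order_antisym)
    then have "y = x" "w = x"
      using True by (simp_all add: y w m_def scaleR_2)
    then have "c = x"
      unfolding c by (intro circ_eqI) (simp add: is_circumcenter_def)
    then show ?thesis
      using px x by auto
  next
    case False
    define t where "t = inner (p - x) (p - x) / inner (q - x) (q - x)"
    define d where "d = x + t *\<^sub>R (q - x)"
    have t0: "0 \<le> t" by (simp add: t_def)
    have dU: "d \<in> U"
      using mem_affine[OF U x q, of "1 - t" t] by (simp add: d_def algebra_simps)
    have "inner (q - x) (p - x) = inner (q - x) (q - x)"
      using orth[OF q x] by (simp add: inner_diff_left inner_diff_right inner_commute)
    then have dp: "inner (d - x) (p - x) = inner (p - x) (p - x)"
      using False by (simp add: d_def t_def)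
    have "d = (1 - t / 2) *\<^sub>R x + (t / 4) *\<^sub>R y + (t / 4) *\<^sub>R w"
      by (simp add: d_def w m_def algebra_simps flip: scaleR_left_distrib)
    then have hull: "d \<in> affine hull {x, y, w}"
      unfolding affine_hull_3 by (intro CollectI exI[of _ "1 - t/2"] exI[of _ "t/4"]) simp
    have "d - y = (d - x) - 2 *\<^sub>R (p - x)"
      by (simp add: y scaleR_2)
    then have "inner (d - y) (d - y) = inner (d - x) (d - x)
        - 4 * inner (d - x) (p - x) + 4 * inner (p - x) (p - x)"
      by (simp only: inner_diff_left[of "d - x" "2 *\<^sub>R (p - x)"]
          inner_diff_right[of _ "d - x" "2 *\<^sub>R (p - x)"])
        (simp add: inner_commute[of "p - x" "d - x"])
    then have "inner (d - y) (d - y) = inner (d - x) (d - x)"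
      using dp by simp
    then have e1: "dist d x = dist d y"
      by (simp add: dist_norm norm_eq)
    have "inner (d - m) (y - m) = 0"
      using orth[OF dU m] by (simp add: ym inner_commute)
    moreover have "d - w = (d - m) + (y - m)" "d - y = (d - m) - (y - m)"
      by (simp_all add: w scaleR_2)
    moreover have "inner (f - h) (f - h) = inner (f + h) (f + h)" if "inner f h = 0" for f h :: 'a
      using that by (simp add: inner_diff_left inner_diff_right inner_add_left inner_add_right
          inner_commute)
    ultimately have "inner (d - y) (d - y) = inner (d - w) (d - w)"
      by metis
    then have e2: "dist d y = dist d w"
      by (simp add: dist_norm norm_eq)
    have cd: "c = d"
      unfolding c using hull e1 e2 by (intro circ_eqI) (simp add: is_circumcenter_def)
    have "inner (x - p) (d - p) = 0"
      using dp by (simp add: inner_diff_left inner_diff_right inner_commute)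
    moreover have "inner (x - d) (u - d) = t * inner (x - p) (u - d)" if "u \<in> U" for u
    proof -
      have "inner (x - q) (u - d) = inner (x - p) (u - d)"
        using orth[OF that dU] by (simp add: inner_diff_left)
      moreover have "x - d = t *\<^sub>R (x - q)"
        by (simp add: d_def algebra_simps)
      ultimately show ?thesis by simp
    qed
    ultimately show ?thesis
      using dU t0 cd by blast
  qed
qed

text \<open>The set \<open>K\<close> lies in the half-space behind the hyperplane through its closest point, so the
  angle at the circumcenter between \<open>x\<close> and \<open>s\<close> is obtuse.\<close>

lemma CRM_op_pythagoras:
  fixes K U :: "'a::euclidean_space set"
  assumes K: "closed K" "convex K" and U: "affine U" and x: "x \<in> U" and s: "s \<in> K \<inter> U"
  shows "(dist x (CRM_op K U x))\<^sup>2 + (dist (CRM_op K U x) s)\<^sup>2 \<le> (dist x s)\<^sup>2"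
proof -
  let ?c = "CRM_op K U x" and ?p = "closest_point K x"
  obtain t where t: "0 \<le> t" "inner (x - ?c) (s - ?c) = t * inner (x - ?p) (s - ?c)"
    and cp: "inner (x - ?p) (?c - ?p) = 0"
    using CRM_op_characterization[OF K U _ x] s by blast
  have "inner (x - ?p) (s - ?p) \<le> 0"
    using closest_point_dot[OF K(2,1)] s by blast
  with cp have "inner (x - ?p) (s - ?c) \<le> 0"
    by (simp add: inner_diff_right)
  with t have "inner (x - ?c) (s - ?c) \<le> 0"
    by (simp add: mult_nonneg_nonpos)
  then show ?thesis
    by (simp add: dist_norm power2_norm_eq_inner inner_diff_left inner_diff_right inner_commute)
qed

text \<open>The error bound enters twice: at \<open>x\<close>, and at the circumcenter, whose distance to \<open>K\<close> is at
  most its distance to \<open>closest_point K x\<close>. The second use produces the denominator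
  \<open>1 + w\<^sup>2\<close>.\<close>

lemma CRM_op_contracts:
  fixes K U :: "'a::euclidean_space set"
  assumes K: "closed K" "convex K" and U: "affine U" and ne: "K \<inter> U \<noteq> {}"
    and w: "0 \<le> w" "w \<le> 1"
    and eb: "\<And>u. u \<in> U \<Longrightarrow> w * infdist u (K \<inter> U) \<le> infdist u K" and x: "x \<in> U"
  shows "infdist (CRM_op K U x) (K \<inter> U)
    \<le> sqrt ((1 - w\<^sup>2) / (1 + w\<^sup>2)) * infdist x (K \<inter> U)"
proof -
  let ?S = "K \<inter> U" and ?p = "closest_point K x" and ?c = "CRM_op K U x"
  have S: "closed ?S" using K affine_closed[OF U] by blast
  have c: "?c \<in> U" "inner (x - ?p) (?c - ?p) = 0"
    using CRM_op_characterization[OF K U ne x] by auto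
  define s where "s = closest_point ?S x"
  have s: "s \<in> ?S" using S ne unfolding s_def by (rule closest_point_in_set)
  have xs: "infdist x ?S = dist x s" unfolding s_def by (rule infdist_eq_dist_closest_point[OF S ne])
  have xp: "infdist x K = dist x ?p"
    using K ne by (intro infdist_eq_dist_closest_point) auto
  have "?p \<in> K" using K ne by (intro closest_point_in_set) auto
  then have "w * infdist ?c ?S \<le> dist ?c ?p"
    using eb[OF c(1)] infdist_le order_trans by blast
  then have "w\<^sup>2 * (infdist ?c ?S)\<^sup>2 \<le> (dist ?c ?p)\<^sup>2"
    using power_mono[of "w * infdist ?c ?S" "dist ?c ?p" 2] w by (simp add: power_mult_distrib infdist_nonneg)
  also have "\<dots> = (dist x ?c)\<^sup>2 - (dist x ?p)\<^sup>2"
    using c(2)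
    by (simp add: dist_norm power2_norm_eq_inner inner_diff_left inner_diff_right inner_commute)
  finally have 1: "w\<^sup>2 * (infdist ?c ?S)\<^sup>2 \<le> (dist x ?c)\<^sup>2 - (dist x ?p)\<^sup>2" .
  have "(infdist ?c ?S)\<^sup>2 \<le> (dist ?c s)\<^sup>2"
    using s by (intro power_mono infdist_le infdist_nonneg)
  also have "\<dots> \<le> (infdist x ?S)\<^sup>2 - (dist x ?c)\<^sup>2"
    using CRM_op_pythagoras[OF K U x s] by (simp add: xs)
  finally have 2: "(infdist ?c ?S)\<^sup>2 \<le> (infdist x ?S)\<^sup>2 - (dist x ?c)\<^sup>2" .
  have 3: "w\<^sup>2 * (infdist x ?S)\<^sup>2 \<le> (dist x ?p)\<^sup>2"
    using power_mono[OF eb[OF x], of 2] w by (simp add: power_mult_distrib infdist_nonneg xp)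
  have "(1 + w\<^sup>2) * (infdist ?c ?S)\<^sup>2 \<le> (1 - w\<^sup>2) * (infdist x ?S)\<^sup>2"
    using 1 2 3 by (simp add: algebra_simps)
  moreover have "0 < 1 + w\<^sup>2"
    by (simp add: add_pos_nonneg)
  ultimately have "(infdist ?c ?S)\<^sup>2 \<le> (1 - w\<^sup>2) / (1 + w\<^sup>2) * (infdist x ?S)\<^sup>2"
    by (simp add: field_simps)
  then have "infdist ?c ?S \<le> sqrt ((1 - w\<^sup>2) / (1 + w\<^sup>2) * (infdist x ?S)\<^sup>2)"
    by (rule real_le_rsqrt)
  then show ?thesis
    by (simp only: real_sqrt_mult real_sqrt_abs abs_of_nonneg[OF infdist_nonneg])
qed

section \<open>Convergence rates\<close>

theorem theorem3p5:
  fixes K U :: "'a::euclidean_space set"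
    and \<omega> :: real
    and z x :: "nat \<Rightarrow> 'a"
  assumes "closed K" and "convex K"
    and "affine U"
    and "K \<inter> U \<noteq> {}"
    and "0 < \<omega>" and "\<omega> < 1"
    and "\<forall>u\<in>U. infdist u K \<ge> \<omega> * infdist u (K \<inter> U)"
    and "\<forall>k. z (Suc k) = MAP_op K U (z k)"
    and "x 0 \<in> U" and "\<forall>k. x (Suc k) = CRM_op K U (x k)"
  shows "(\<exists>l\<in>K \<inter> U. z \<longlonglongrightarrow> l \<and> converges_R_linearly z l
            \<and> R_constant z l \<le> ereal (sqrt (1 - \<omega>\<^sup>2)))
       \<and> (\<exists>l\<in>K \<inter> U. x \<longlonglongrightarrow> l \<and> converges_R_linearly x l
            \<and> R_constant x l \<le> ereal (sqrt ((1 - \<omega>\<^sup>2) / (1 + \<omega>\<^sup>2))))"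
proof -
  let ?S = "K \<inter> U"
  note K = assms(1,2) and U = assms(3) and ne = assms(4)
  have w: "0 \<le> \<omega>" "\<omega> \<le> 1" using assms(5,6) by auto
  have eb: "\<omega> * infdist u ?S \<le> infdist u K" if "u \<in> U" for u
    using assms(7) that by blast
  have S: "closed ?S" using K affine_closed[OF U] by blast
  have w2: "0 < \<omega>\<^sup>2" "\<omega>\<^sup>2 < 1"
    using assms(5,6) by (auto simp: power_less_one_iff)
  define b where "b = sqrt (1 - \<omega>\<^sup>2)"
  define g where "g = sqrt ((1 - \<omega>\<^sup>2) / (1 + \<omega>\<^sup>2))"
  have b: "0 < b" "b < 1" using w2 by (auto simp: b_def)
  have g: "0 < g" "g < 1" using w2 by (auto simp: g_def field_simps add_pos_pos)
  have zU: "z (Suc k) \<in> U" for k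
    using assms(8) ne affine_closed[OF U] by (auto simp: MAP_op_def intro!: closest_point_in_set)
  have xU: "x k \<in> U" for k
    by (induction k) (use assms(9,10) CRM_op_characterization[OF K U ne] in auto)
  \<comment> \<open>The start \<open>z 0\<close> need not lie in \<open>U\<close>, so the contraction holds only from \<open>z 1\<close> on; the
    constant absorbs the first step.\<close>
  define c where "c = max (infdist (z 0) ?S) (infdist (z 1) ?S / b)"
  have zgeo: "infdist (z k) ?S \<le> c * b ^ k" for k
  proof (cases k)
    case 0
    then show ?thesis by (simp add: c_def)
  next
    case (Suc j)
    have "infdist (z (Suc j)) ?S \<le> c * b ^ Suc j"
    proof (induction j)
      case 0
      have "infdist (z 1) ?S / b \<le> c" by (simp add: c_def)
      then show ?case using b by (simp add: field_simps)
    next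
      case (Suc j)
      have "infdist (z (Suc (Suc j))) ?S \<le> b * infdist (z (Suc j)) ?S"
        using MAP_op_contracts[OF K U ne w eb[OF zU]] assms(8) by (simp add: b_def)
      also have "\<dots> \<le> b * (c * b ^ Suc j)"
        using Suc.IH b by (intro mult_left_mono) auto
      finally show ?case by (simp add: mult_ac)
    qed
    then show ?thesis using Suc by simp
  qed
  have xgeo: "infdist (x k) ?S \<le> infdist (x 0) ?S * g ^ k" for k
  proof (induction k)
    case (Suc k)
    have "infdist (x (Suc k)) ?S \<le> g * infdist (x k) ?S"
      using CRM_op_contracts[OF K U ne w eb xU] assms(10) by (simp add: g_def)
    also have "\<dots> \<le> g * (infdist (x 0) ?S * g ^ k)"
      using Suc.IH g by (intro mult_left_mono) auto
    finally show ?case by (simp add: mult_ac)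
  qed simp
  have zfejer: "dist (z (Suc k)) s \<le> dist (z k) s" if "s \<in> ?S" for k s
    using MAP_op_Fejer[OF K U that] assms(8) by simp
  have xfejer: "dist (x (Suc k)) s \<le> dist (x k) s" if "s \<in> ?S" for k s
  proof (rule power2_le_imp_le)
    have "(dist (x k) (x (Suc k)))\<^sup>2 + (dist (x (Suc k)) s)\<^sup>2 \<le> (dist (x k) s)\<^sup>2"
      using CRM_op_pythagoras[OF K U xU that, of k] assms(10) by simp
    then show "(dist (x (Suc k)) s)\<^sup>2 \<le> (dist (x k) s)\<^sup>2"
      using zero_le_power2[of "dist (x k) (x (Suc k))"] by linarith
  qed simp
  show ?thesis
    using Fejer_geometric_imp_R_linear[OF S ne zfejer zgeo b]
      Fejer_geometric_imp_R_linear[OF S ne xfejer xgeo g]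
    unfolding b_def g_def by blast
qed

end
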